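(* Let $\mathcal{H}$ be a real Hilbert space and let $f:\mathcal{H}\to\mathbb{R}$ be convex, of class $\mathcal{C}^1$, with $\nabla f$ Lipschitz continuous on bounded subsets of $\mathcal{H}$, and with $S:=\operatorname{argmin}_{\mathcal{H}} f\neq\emptyset$; let $x^*$ be the element of minimum norm of $S$. Let $\varepsilon:[t_0,+\infty[\to\,]0,+\infty[$ be nonincreasing, of class $\mathcal{C}^1$, with $\lim_{t\to+\infty}\varepsilon(t)=0$. Let $x:[t_0,+\infty[\to\mathcal{H}$ be a solution trajectory of $$\dot x(t)+\nabla f(x(t))+\varepsilon(t)x(t)=0 .$$ Let $\varphi_t$, $x_{\varepsilon(t)}$ and $E(t)$ be as defined in the context, and for a given $t_1\geq t_0$ let $\gamma(t):=\exp\left(\int_{t_1}^t\varepsilon(s)\,ds\right)$. 1. There exists $t_1>0$, $t_1\ge t_0$, such that for all $t\ge t_1$: $$E(t)\le \frac{\gamma(t_1)E(t_1)}{\gamma(t)}-\frac{\|x^*\|^2}{\gamma(t)}\int_{t_1}^t\dot\varepsilon(s)\gamma(s)\,ds ;$$ $$f(x(t))-\min_{\mathcal{H}} f\le \frac{\gamma(t_1)E(t_1)}{\gamma(t)}+\frac{\|x^*\|^2}{2}\left[\varepsilon(t)-\frac{2}{\gamma(t)}\int_{t_1}^t\dot\varepsilon(s)\gamma(s)\,ds\right];$$ $$\|x(t)-x_{\varepsilon(t)}\|^2\le\frac{E(t)}{\varepsilon(t)}\le\frac{\gamma(t_1)E(t_1)}{\varepsilon(t)\gamma(t)}-\frac{\|x^*\|^2}{\varepsilon(t)\gamma(t)}\int_{t_1}^t\dot\varepsilon(s)\gamma(s)\,ds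 .$$ 2. Suppose that one of the two following conditions is satisfied: (i) $\lim_{t\to+\infty}\frac{E(t)}{\varepsilon(t)}=0$; or (ii) $\int_{t_0}^{+\infty}\varepsilon(t)\,dt=+\infty$. Then $x(t)$ converges strongly (in norm) to $x^*$ as $t\to+\infty$.
   Context: For $t\ge t_0$, $\varphi_t:\mathcal{H}\to\mathbb{R}$ is defined by $\varphi_t(x):=f(x)+\frac{\varepsilon(t)}{2}\|x\|^2$. For $\varepsilon>0$, $x_\varepsilon$ denotes the unique minimizer over $\mathcal{H}$ of $\xi\mapsto f(\xi)+\frac{\varepsilon}{2}\|\xi\|^2$; thus $x_{\varepsilon(t)}=\operatorname{argmin}_{\mathcal{H}}\varphi_t$. The energy function is $$E(t):=\varphi_t(x(t))-\varphi_t(x_{\varepsilon(t)})+\frac{\varepsilon(t)}{2}\|x(t)-x_{\varepsilon(t)}\|^2 .$$ A solution trajectory is a function of class $\mathcal{C}^1$ satisfying the differential equation for all $t\ge t_0$. *)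

theory Defs
  imports "HOL-Analysis.Analysis"
begin

definition argmin_set :: "('a \<Rightarrow> real) \<Rightarrow> 'a set" where
  "argmin_set f = {z. is_arg_min f (\<lambda>_. True) z}"

definition min_norm_argmin :: "('a::real_normed_vector \<Rightarrow> real) \<Rightarrow> 'a" where
  "min_norm_argmin f = (THE z. is_arg_min norm (\<lambda>y. y \<in> argmin_set f) z)"

definition tikhonov :: "('a::real_normed_vector \<Rightarrow> real) \<Rightarrow> real \<Rightarrow> 'a \<Rightarrow> real" where
  "tikhonov f e \<xi> = f \<xi> + e / 2 * (norm \<xi>)\<^sup>2"

definition tikhonov_min :: "('a::real_normed_vector \<Rightarrow> real) \<Rightarrow> real \<Rightarrow> 'a" where
  "tikhonov_min f e = (THE z. is_arg_min (tikhonov f e) (\<lambda>_. True) z)"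

definition energy ::
  "('a::real_normed_vector \<Rightarrow> real) \<Rightarrow> (real \<Rightarrow> real) \<Rightarrow> (real \<Rightarrow> 'a) \<Rightarrow> real \<Rightarrow> real" where
  "energy f \<epsilon> x t =
     tikhonov f (\<epsilon> t) (x t) - tikhonov f (\<epsilon> t) (tikhonov_min f (\<epsilon> t))
     + \<epsilon> t / 2 * (norm (x t - tikhonov_min f (\<epsilon> t)))\<^sup>2"

definition gam :: "(real \<Rightarrow> real) \<Rightarrow> real \<Rightarrow> real \<Rightarrow> real" where
  "gam \<epsilon> t1 t = exp (integral {t1..t} \<epsilon>)"

text \<open>The argument \<open>g\<close> stands for the gradient of \<open>f\<close>. Derivatives are taken within
  \<open>{t0..}\<close>, hence one-sided at \<open>t0\<close>.\<close>

definition solution_trajectory ::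
  "('a::real_normed_vector \<Rightarrow> 'a) \<Rightarrow> (real \<Rightarrow> real) \<Rightarrow> real \<Rightarrow> (real \<Rightarrow> 'a) \<Rightarrow> bool" where
  "solution_trajectory g \<epsilon> t0 x \<longleftrightarrow>
     (\<exists>x'. continuous_on {t0..} x' \<and>
       (\<forall>t\<ge>t0. (x has_vector_derivative x' t) (at t within {t0..}) \<and>
                x' t + g (x t) + \<epsilon> t *\<^sub>R x t = 0))"

end

theory Submission imports Defs begin

text \<open>
  Write \<open>\<phi>\<^sub>e = f + (e/2) \<bar>\<cdot>\<bar>\<^sup>2\<close>, \<open>y\<^sub>e\<close> for its minimizer and \<open>N\<close> for the norm of the minimum norm
  solution \<open>x\<^sup>*\<close>.

  \<^emph>\<open>Energy decay.\<close> Let \<open>V\<^sub>e(v) = \<phi>\<^sub>e(v) - \<phi>\<^sub>e(y\<^sub>e) + (e/2) \<bar>v - y\<^sub>e\<bar>\<^sup>2\<close>, so that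
  \<open>E(t) = V\<^sub>e(x(t))\<close> with \<open>e = \<epsilon>(t)\<close>. While \<open>e\<close> is held fixed, strong convexity of \<open>\<phi>\<^sub>e\<close> makes the flow dissipate
  \<open>V\<^sub>e\<close> at rate at least \<open>e V\<^sub>e\<close> (\<open>frozen_energy_dissipation\<close>). When \<open>e\<close> decreases to \<open>d\<close> while the point
  is held fixed, the energy rises by at most \<open>(e - d) N\<^sup>2\<close> (\<open>frozen_energy_decrease_parameter\<close>).
  Together these say \<open>E' + \<epsilon> E \<le> - \<epsilon>' N\<^sup>2\<close>, and multiplying by \<open>\<gamma>\<close> and integrating gives the bound
  on \<open>E\<close>. The other estimates follow from \<open>\<epsilon> \<bar>x - y\<^sub>\<epsilon>\<bar>\<^sup>2 \<le> E\<close> and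
  \<open>f(x) - min f \<le> E + (\<epsilon>/2) N\<^sup>2\<close>.

  The map \<open>e \<mapsto> y\<^sub>e\<close> is only locally Lipschitz, and in infinite dimension its differentiability is a
  delicate matter. Differentiating \<open>E\<close> is therefore avoided: just to the right of
  each time \<open>t\<close>, the weighted energy lies below a differentiable function that
  agrees with it at \<open>t\<close> and has nonpositive slope there, and this suffices for monotonicity
  (\<open>nonincreasing_if_right_majorants\<close>). The estimates then hold from every starting time.

  \<^emph>\<open>Strong convergence.\<close> Comparing the two minimality inequalities at parameters \<open>d \<le> e\<close> yields
  \<open>\<bar>y\<^sub>d - y\<^sub>e\<bar>\<^sup>2 \<le> \<bar>y\<^sub>d\<bar>\<^sup>2 - \<bar>y\<^sub>e\<bar>\<^sup>2\<close>. The norms are bounded by \<open>N\<close>, so the path is Cauchy as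
  \<open>e\<close> tends to \<open>0\<close>, and its limit is \<open>x\<^sup>*\<close> (\<open>tikhonov_path_tendsto\<close>).
  If \<open>E/\<epsilon>\<close> tends to \<open>0\<close>, then \<open>x - y\<^sub>\<epsilon>\<close> tends to \<open>0\<close> and \<open>x\<close> follows the path.
  If instead \<open>\<epsilon>\<close> has infinite integral, strong convexity gives for \<open>\<theta> = \<bar>x - x\<^sup>*\<bar>\<^sup>2\<close>
  the inequality \<open>\<theta>' + \<epsilon> \<theta> \<le> \<epsilon> (N\<^sup>2 - \<bar>y\<^sub>\<epsilon>\<bar>\<^sup>2)\<close>. The bracket tends to \<open>0\<close>, and the divergence
  of \<open>\<gamma>\<close> makes the initial value of \<open>\<theta>\<close> irrelevant.
\<close>

section \<open>Monotonicity from one-sided majorants\<close>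

text \<open>
  A one-sided comparison principle for functions that need not be differentiable. Tilting
  \<open>u\<close> by a small slope \<open>\<eta>\<close> makes every majorant strictly decreasing at its contact point. Hence
  the last time at which the tilted function is at most its initial value cannot precede \<open>b\<close>.
\<close>

lemma nonincreasing_if_right_majorants:
  fixes u :: "real \<Rightarrow> real"
  assumes ab: "a \<le> b"
    and cont: "continuous_on {a..b} u"
    and majorant: "\<And>t. a \<le> t \<Longrightarrow> t < b \<Longrightarrow>
      \<exists>M D. M t = u t \<and> (\<forall>s\<in>{t..b}. u s \<le> M s) \<and>
        (M has_real_derivative D) (at t within {t..b}) \<and> D \<le> 0"
  shows "u b \<le> u a"
proof (rule field_le_epsilon)
  fix \<delta> :: real assume "0 < \<delta>"
  define \<eta> where "\<eta> = \<delta> / (b - a + 1)"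
  have eta: "0 < \<eta>" using \<open>0 < \<delta>\<close> ab by (simp add: \<eta>_def)
  define w where "w = (\<lambda>s. u s - u a - \<eta> * (s - a))"
  have w_cont: "continuous_on {a..b} w"
    unfolding w_def by (intro continuous_intros cont)
  define K where "K = {a..b} \<inter> w -` {..0}"
  have "closed K"
    unfolding K_def by (rule continuous_closed_preimage[OF w_cont]) auto
  moreover have "bounded K"
    unfolding K_def by (rule bounded_subset[of "{a..b}"]) auto
  ultimately have "compact K" by (simp add: compact_eq_bounded_closed)
  moreover have "a \<in> K" using ab by (simp add: K_def w_def)
  ultimately obtain c where c: "c \<in> K" "\<And>s. s \<in> K \<Longrightarrow> s \<le> c"
    using compact_attains_sup[of K] by auto
  have "c = b"
  proof (rule ccontr)
    assume "c \<noteq> b"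
    then have cb: "a \<le> c" "c < b" "w c \<le> 0" using c(1) by (auto simp: K_def)
    obtain M D where M: "M c = u c" "\<And>s. s \<in> {c..b} \<Longrightarrow> u s \<le> M s"
      "(M has_real_derivative D) (at c within {c..b})" "D \<le> 0"
      using majorant[OF cb(1,2)] by blast
    have "((\<lambda>s. M s - u a - \<eta> * (s - a)) has_real_derivative D - \<eta>) (at c within {c..b})"
      by (auto intro!: derivative_eq_intros M(3))
    from has_real_derivative_neg_dec_right[OF this] M(4) eta
    obtain d where d: "d > 0" "\<And>h. h > 0 \<Longrightarrow> c + h \<in> {c..b} \<Longrightarrow> h < d \<Longrightarrow>
      M (c + h) - u a - \<eta> * (c + h - a) < M c - u a - \<eta> * (c - a)"
      by auto
    define h where "h = min (d / 2) (b - c)"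
    have h: "h > 0" "c + h \<in> {c..b}" "h < d"
      using d(1) cb by (auto simp: h_def min_def)
    have "w (c + h) \<le> 0"
      using d(2)[OF h] M(1) M(2)[OF h(2)] cb(3) by (simp add: w_def)
    then have "c + h \<in> K" using h cb by (simp add: K_def)
    from c(2)[OF this] h(1) show False by simp
  qed
  then have "u b \<le> u a + \<eta> * (b - a)" using c(1) by (simp add: K_def w_def)
  also have "\<eta> * (b - a) \<le> \<delta>"
    using \<open>0 < \<delta>\<close> ab by (simp add: \<eta>_def field_simps)
  finally show "u b \<le> u a + \<delta>" by simp
qed

section \<open>The Tikhonov path\<close>

lemma Cauchy_if_square_dist_le:
  fixes z :: "nat \<Rightarrow> 'a::real_normed_vector" and r :: "nat \<Rightarrow> real"
  assumes "\<And>m n. m \<le> n \<Longrightarrow> (norm (z n - z m))\<^sup>2 \<le> r m" and "r \<longlonglongrightarrow> 0"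
  shows "Cauchy z"
proof (rule metric_CauchyI)
  fix d :: real assume d: "0 < d"
  have "eventually (\<lambda>n. r n < (d / 2)\<^sup>2) sequentially"
    using assms(2) d by (intro order_tendstoD(2)) auto
  then obtain M where M: "r M < (d / 2)\<^sup>2" by (auto simp: eventually_sequentially)
  have near: "norm (z n - z M) < d / 2" if "n \<ge> M" for n
  proof (rule power_less_imp_less_base)
    show "(norm (z n - z M))\<^sup>2 < (d / 2)\<^sup>2" using assms(1)[OF that] M by linarith
  qed (use d in simp)
  have "dist (z m) (z n) < d" if "m \<ge> M" "n \<ge> M" for m n
    using dist_triangle_half_r[of "z M" "z m" d "z n"] near[OF that(1)] near[OF that(2)]
    by (simp add: dist_norm norm_minus_commute)
  then show "\<exists>M. \<forall>m\<ge>M. \<forall>n\<ge>M. dist (z m) (z n) < d" by blast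
qed

locale convex_attaining_min =
  fixes f :: "'a::{real_inner, complete_space} \<Rightarrow> real"
  assumes convex: "convex_on UNIV f"
    and cont: "continuous_on UNIV f"
    and attained: "argmin_set f \<noteq> {}"
begin

lemma argmin_le: "z \<in> argmin_set f \<Longrightarrow> f z \<le> f v"
  by (auto simp: argmin_set_def is_arg_min_linorder)

lemma tikhonov_strongly_convex:
  assumes "0 \<le> l" "l \<le> 1"
  shows "tikhonov f e ((1 - l) *\<^sub>R a + l *\<^sub>R b)
    \<le> (1 - l) * tikhonov f e a + l * tikhonov f e b - e / 2 * (l * (1 - l)) * (norm (a - b))\<^sup>2"
proof -
  have "f ((1 - l) *\<^sub>R a + l *\<^sub>R b) \<le> (1 - l) * f a + l * f b"
    using convex_onD[OF convex] assms by auto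
  moreover have "(norm ((1 - l) *\<^sub>R a + l *\<^sub>R b))\<^sup>2
      = (1 - l) * (norm a)\<^sup>2 + l * (norm b)\<^sup>2 - l * (1 - l) * (norm (a - b))\<^sup>2"
    unfolding power2_norm_eq_inner
    by (simp add: inner_commute algebra_simps)
  then have "e / 2 * (norm ((1 - l) *\<^sub>R a + l *\<^sub>R b))\<^sup>2
      = (1 - l) * (e / 2 * (norm a)\<^sup>2) + l * (e / 2 * (norm b)\<^sup>2)
        - e / 2 * (l * (1 - l)) * (norm (a - b))\<^sup>2"
    by (simp only: right_diff_distrib distrib_left mult.assoc mult.left_commute left_diff_distrib)
  ultimately show ?thesis
    unfolding tikhonov_def distrib_left by linarith
qed

lemma tikhonov_continuous: "continuous_on UNIV (tikhonov f e)"
  unfolding tikhonov_def by (intro continuous_intros cont)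

text \<open>
  Strong convexity between \<open>p\<close> and \<open>z\<close> loses a factor \<open>k\<close> at the point that has weight \<open>k\<close> on \<open>p\<close>;
  the full modulus is recovered as \<open>k\<close> tends to \<open>1\<close>.
\<close>

lemma tikhonov_quadratic_growth:
  assumes p: "\<And>z. tikhonov f e p \<le> tikhonov f e z"
  shows "tikhonov f e p + e / 2 * (norm (z - p))\<^sup>2 \<le> tikhonov f e z"
proof -
  have "e / 2 * (norm (z - p))\<^sup>2 \<le> tikhonov f e z - tikhonov f e p"
  proof (rule field_le_mult_one_interval)
    fix k :: real assume k: "0 < k" "k < 1"
    have "tikhonov f e p \<le> tikhonov f e ((1 - (1 - k)) *\<^sub>R p + (1 - k) *\<^sub>R z)" by (rule p)
    also have "\<dots> \<le> (1 - (1 - k)) * tikhonov f e p + (1 - k) * tikhonov f e z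
        - e / 2 * ((1 - k) * (1 - (1 - k))) * (norm (p - z))\<^sup>2"
      by (rule tikhonov_strongly_convex) (use k in auto)
    finally have "(1 - k) * (k * (e / 2 * (norm (z - p))\<^sup>2)) \<le> (1 - k) * (tikhonov f e z - tikhonov f e p)"
      by (simp add: algebra_simps norm_minus_commute)
    then show "k * (e / 2 * (norm (z - p))\<^sup>2) \<le> tikhonov f e z - tikhonov f e p"
      using k by simp
  qed
  then show ?thesis by simp
qed

text \<open>
  Strong convexity at midpoints makes any minimizing sequence Cauchy, so completeness
  takes the place of weak compactness.
\<close>

lemma tikhonov_minimizer_exists:
  assumes e: "0 < e"
  shows "\<exists>p. \<forall>z. tikhonov f e p \<le> tikhonov f e z"
proof -
  define \<phi> where "\<phi> = tikhonov f e"
  obtain z0 where "z0 \<in> argmin_set f" using attained by auto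
  then have "f z0 \<le> \<phi> z" for z
    using argmin_le[of z0 z] e by (simp add: \<phi>_def tikhonov_def add_increasing2)
  then have bdd: "bdd_below (range \<phi>)" by (auto intro!: bdd_belowI)
  define m where "m = (INF z. \<phi> z)"
  have m_le: "m \<le> \<phi> z" for z unfolding m_def by (rule cINF_lower[OF bdd]) simp
  have "\<exists>z. \<phi> z < m + 1 / real (Suc n)" for n
    using cInf_lessD[of "range \<phi>" "m + 1 / real (Suc n)"] by (auto simp: m_def)
  then obtain z where z: "\<And>n. \<phi> (z n) < m + 1 / real (Suc n)" by metis
  have "Cauchy z"
  proof (rule Cauchy_if_square_dist_le)
    fix k n :: nat assume kn: "k \<le> n"
    have "m \<le> \<phi> (z n) / 2 + \<phi> (z k) / 2 - e / 8 * (norm (z n - z k))\<^sup>2"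
      using order_trans[OF m_le tikhonov_strongly_convex[of "1/2" e "z n" "z k", folded \<phi>_def]]
      by simp
    moreover have "1 / real (Suc n) \<le> 1 / real (Suc k)" using kn by (simp add: frac_le)
    ultimately have "e / 8 * (norm (z n - z k))\<^sup>2 \<le> 1 / real (Suc k)"
      using z[of n] z[of k] by linarith
    then show "(norm (z n - z k))\<^sup>2 \<le> 8 / e * (1 / real (Suc k))"
      using mult_left_mono[of "e / 8 * (norm (z n - z k))\<^sup>2" "1 / real (Suc k)" "8 / e"] e
      by simp
  next
    show "(\<lambda>k. 8 / e * (1 / real (Suc k))) \<longlonglongrightarrow> 0"
      using tendsto_mult_right_zero[OF LIMSEQ_inverse_real_of_nat, of "8 / e"]
      by (simp only: inverse_eq_divide)
  qed
  then obtain p where p: "z \<longlonglongrightarrow> p" using Cauchy_convergent_iff convergent_def by blast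
  have "isCont \<phi> p"
    using tikhonov_continuous by (simp add: \<phi>_def continuous_on_eq_continuous_at)
  then have "(\<lambda>n. \<phi> (z n)) \<longlonglongrightarrow> \<phi> p" using p by (rule isCont_tendsto_compose)
  moreover have "(\<lambda>n. m + 1 / real (Suc n)) \<longlonglongrightarrow> m"
    using LIMSEQ_inverse_real_of_nat_add[of m] by (simp add: inverse_eq_divide)
  ultimately have "\<phi> p \<le> m"
    by (rule LIMSEQ_le) (use z less_imp_le in blast)
  then have "tikhonov f e p \<le> tikhonov f e v" for v
    using m_le[of v] by (simp add: \<phi>_def)
  then show ?thesis by blast
qed

lemma tikhonov_min_le:
  assumes e: "0 < e"
  shows "tikhonov f e (tikhonov_min f e) \<le> tikhonov f e z"
proof -
  obtain p where "\<forall>z. tikhonov f e p \<le> tikhonov f e z"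
    using tikhonov_minimizer_exists[OF e] ..
  then have p: "tikhonov f e p \<le> tikhonov f e z" for z ..
  have "tikhonov_min f e = p"
    unfolding tikhonov_min_def
  proof (rule the_equality)
    show "is_arg_min (tikhonov f e) (\<lambda>_. True) p"
      using p by (simp add: is_arg_min_linorder)
    fix q assume "is_arg_min (tikhonov f e) (\<lambda>_. True) q"
    then have "tikhonov f e q \<le> tikhonov f e p" by (simp add: is_arg_min_linorder)
    with tikhonov_quadratic_growth[OF p, of q] have "e / 2 * (norm (q - p))\<^sup>2 \<le> 0" by linarith
    with e show "q = p" by (simp add: mult_le_0_iff)
  qed
  with p show ?thesis by simp
qed

lemmas tikhonov_min_growth = tikhonov_quadratic_growth[OF tikhonov_min_le]

text \<open>
  The two minimizers are competitors of each other. In the sum of the two growth inequalities the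
  values of \<open>f\<close> cancel and only norms remain.
\<close>

lemma tikhonov_path_step:
  assumes d: "0 < d" and e: "0 < e"
  shows "(e + d) * (norm (tikhonov_min f d - tikhonov_min f e))\<^sup>2
    \<le> (e - d) * ((norm (tikhonov_min f d))\<^sup>2 - (norm (tikhonov_min f e))\<^sup>2)"
  using tikhonov_min_growth[OF e, of "tikhonov_min f d"]
    tikhonov_min_growth[OF d, of "tikhonov_min f e"]
  by (simp add: tikhonov_def norm_minus_commute field_simps)

lemma tikhonov_path_norm_gap:
  assumes d: "0 < d" and de: "d \<le> e"
  shows "(norm (tikhonov_min f d - tikhonov_min f e))\<^sup>2
    \<le> (norm (tikhonov_min f d))\<^sup>2 - (norm (tikhonov_min f e))\<^sup>2" (is "?q \<le> ?r")
proof (cases "e = d")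
  case False
  have step: "(e + d) * ?q \<le> (e - d) * ?r" using tikhonov_path_step d de by auto
  moreover have "(e - d) * ?q \<le> (e + d) * ?q"
    using d by (intro mult_right_mono) auto
  ultimately have "(e - d) * ?q \<le> (e - d) * ?r" by linarith
  then show ?thesis using False de by simp
qed simp

text \<open>
  A minimizer of \<open>f\<close> plays the role of \<open>tikhonov_min f d\<close> at \<open>d = 0\<close>.
\<close>

lemma tikhonov_min_norm_gap:
  assumes z: "z \<in> argmin_set f" and e: "0 < e"
  shows "(norm (z - tikhonov_min f e))\<^sup>2 \<le> (norm z)\<^sup>2 - (norm (tikhonov_min f e))\<^sup>2"
proof -
  have "e / 2 * ((norm (tikhonov_min f e))\<^sup>2 + (norm (z - tikhonov_min f e))\<^sup>2) \<le> e / 2 * (norm z)\<^sup>2"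
    using tikhonov_min_growth[OF e, of z] argmin_le[OF z, of "tikhonov_min f e"]
    by (simp add: tikhonov_def algebra_simps)
  then show ?thesis using e by simp
qed

lemma tikhonov_min_norm_le:
  assumes "z \<in> argmin_set f" and "0 < e"
  shows "norm (tikhonov_min f e) \<le> norm z"
proof (rule power2_le_imp_le)
  show "(norm (tikhonov_min f e))\<^sup>2 \<le> (norm z)\<^sup>2"
    using tikhonov_min_norm_gap[OF assms] zero_le_power2[of "norm (z - tikhonov_min f e)"] by linarith
qed simp

text \<open>
  Along \<open>e = 1/(n+1)\<close> the squared norms increase to a finite limit, so the norm gap inequality forces
  the sequence to be Cauchy. Letting the smaller parameter tend to \<open>0\<close> in the same inequality bounds
  the distance from any \<open>tikhonov_min f c\<close> to the limit, which extends convergence to the whole path.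
\<close>

lemma tikhonov_path_limit:
  obtains p where "p \<in> argmin_set f" and "(tikhonov_min f \<longlongrightarrow> p) (at_right 0)"
proof -
  let ?y = "tikhonov_min f"
  obtain z0 where z0: "z0 \<in> argmin_set f" using attained by auto
  define e where "e = (\<lambda>n. 1 / real (Suc n))"
  have e_pos: "0 < e n" for n by (simp add: e_def)
  have e_mono: "e n \<le> e m" if "m \<le> n" for m n using that by (simp add: e_def frac_le)
  have e_lim: "e \<longlonglongrightarrow> 0"
    using LIMSEQ_inverse_real_of_nat by (simp add: e_def inverse_eq_divide)
  have mono: "(norm (?y d))\<^sup>2 \<le> (norm (?y c))\<^sup>2" if "0 < c" "c \<le> d" for c d
    using order_trans[OF zero_le_power2 tikhonov_path_norm_gap[OF that]] by simp
  have "incseq (\<lambda>n. (norm (?y (e n)))\<^sup>2)"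
    by (rule incseq_SucI) (intro mono e_pos e_mono, simp)
  moreover have "(norm (?y (e n)))\<^sup>2 \<le> (norm z0)\<^sup>2" for n
    using tikhonov_min_norm_le[OF z0 e_pos] by (intro power_mono) auto
  ultimately obtain L where L: "(\<lambda>n. (norm (?y (e n)))\<^sup>2) \<longlonglongrightarrow> L"
      "\<And>n. (norm (?y (e n)))\<^sup>2 \<le> L"
    using incseq_convergent[of "\<lambda>n. (norm (?y (e n)))\<^sup>2"] by metis
  have "Cauchy (\<lambda>n. ?y (e n))"
  proof (rule Cauchy_if_square_dist_le)
    fix m n :: nat assume "m \<le> n"
    show "(norm (?y (e n) - ?y (e m)))\<^sup>2 \<le> L - (norm (?y (e m)))\<^sup>2"
      using tikhonov_path_norm_gap[OF e_pos e_mono[OF \<open>m \<le> n\<close>]] L(2)[of n] by linarith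
  next
    show "(\<lambda>m. L - (norm (?y (e m)))\<^sup>2) \<longlonglongrightarrow> 0"
      using tendsto_diff[OF tendsto_const[of L] L(1)] by simp
  qed
  then obtain p where p: "(\<lambda>n. ?y (e n)) \<longlonglongrightarrow> p" using Cauchy_convergent_iff convergent_def by blast
  have gap: "(norm (p - ?y c))\<^sup>2 \<le> (norm p)\<^sup>2 - (norm (?y c))\<^sup>2" if c: "0 < c" for c
  proof (rule LIMSEQ_le)
    show "(\<lambda>n. (norm (?y (e n) - ?y c))\<^sup>2) \<longlonglongrightarrow> (norm (p - ?y c))\<^sup>2"
      by (intro tendsto_intros p)
    show "(\<lambda>n. (norm (?y (e n)))\<^sup>2 - (norm (?y c))\<^sup>2) \<longlonglongrightarrow> (norm p)\<^sup>2 - (norm (?y c))\<^sup>2"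
      by (intro tendsto_intros p)
    have "eventually (\<lambda>n. e n < c) sequentially"
      using e_lim c by (rule order_tendstoD(2))
    then show "\<exists>N. \<forall>n\<ge>N. (norm (?y (e n) - ?y c))\<^sup>2 \<le> (norm (?y (e n)))\<^sup>2 - (norm (?y c))\<^sup>2"
      unfolding eventually_sequentially
      using tikhonov_path_norm_gap[OF e_pos] less_imp_le by blast
  qed
  have "(?y \<longlongrightarrow> p) (at_right 0)"
  proof (rule tendstoI)
    fix d :: real assume d: "0 < d"
    have "(\<lambda>n. (norm p)\<^sup>2 - (norm (?y (e n)))\<^sup>2) \<longlonglongrightarrow> (norm p)\<^sup>2 - (norm p)\<^sup>2"
      by (intro tendsto_intros p)
    then have "eventually (\<lambda>n. (norm p)\<^sup>2 - (norm (?y (e n)))\<^sup>2 < d\<^sup>2) sequentially"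
      using d by (intro order_tendstoD(2)) auto
    then obtain n where n: "(norm p)\<^sup>2 - (norm (?y (e n)))\<^sup>2 < d\<^sup>2"
      by (auto simp: eventually_sequentially)
    have "dist (?y c) p < d" if "0 < c" "c < e n" for c
    proof -
      have "(norm (p - ?y c))\<^sup>2 < d\<^sup>2"
        using gap[OF that(1)] mono[of c "e n"] n that by linarith
      then show ?thesis
        using d by (simp add: dist_norm norm_minus_commute power_less_imp_less_base)
    qed
    then show "eventually (\<lambda>c. dist (?y c) p < d) (at_right 0)"
      using eventually_at_right_less[of 0] order_tendstoD(2)[OF tendsto_ident_at e_pos[of n]]
      by (auto simp: eventually_at_right[OF e_pos[of n]] intro!: exI[of _ "e n"] e_pos)
  qed
  moreover have "p \<in> argmin_set f"
  proof -
    have "f p \<le> f z0 + 0 / 2 * (norm z0)\<^sup>2"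
    proof (rule LIMSEQ_le)
      show "(\<lambda>n. f (?y (e n))) \<longlonglongrightarrow> f p"
        using cont p by (auto simp: continuous_on_eq_continuous_at intro: isCont_tendsto_compose)
      show "(\<lambda>n. f z0 + e n / 2 * (norm z0)\<^sup>2) \<longlonglongrightarrow> f z0 + 0 / 2 * (norm z0)\<^sup>2"
        by (intro tendsto_intros e_lim) simp
      have "f (?y (e n)) \<le> f z0 + e n / 2 * (norm z0)\<^sup>2" for n
      proof -
        have "0 \<le> e n / 2 * (norm (?y (e n)))\<^sup>2" using e_pos[of n] by simp
        then show ?thesis
          using tikhonov_min_le[OF e_pos, of n z0] unfolding tikhonov_def by linarith
      qed
      then show "\<exists>N. \<forall>n\<ge>N. f (?y (e n)) \<le> f z0 + e n / 2 * (norm z0)\<^sup>2" by blast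
    qed
    then have "f p \<le> f v" for v using argmin_le[OF z0, of v] by simp
    then show ?thesis by (simp add: argmin_set_def is_arg_min_linorder)
  qed
  ultimately show thesis by (rule that[rotated])
qed

text \<open>
  For every minimizer \<open>z\<close> of \<open>f\<close>, the norm gap passes to the limit \<open>p\<close> of the path as
  \<open>\<bar>z - p\<bar>\<^sup>2 \<le> \<bar>z\<bar>\<^sup>2 - \<bar>p\<bar>\<^sup>2\<close>. This shows at once that \<open>p\<close> has minimum norm and that no
  other minimizer of \<open>f\<close> does.
\<close>

lemma min_norm_argmin_is_path_limit:
  shows min_norm_argmin_in: "min_norm_argmin f \<in> argmin_set f"
    and tikhonov_path_tendsto: "(tikhonov_min f \<longlongrightarrow> min_norm_argmin f) (at_right 0)"
proof -
  obtain p where p: "p \<in> argmin_set f" "(tikhonov_min f \<longlongrightarrow> p) (at_right 0)"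
    by (rule tikhonov_path_limit)
  have gap: "(norm (z - p))\<^sup>2 \<le> (norm z)\<^sup>2 - (norm p)\<^sup>2" if z: "z \<in> argmin_set f" for z
  proof (rule tendsto_le)
    show "((\<lambda>e. (norm z)\<^sup>2 - (norm (tikhonov_min f e))\<^sup>2) \<longlongrightarrow> (norm z)\<^sup>2 - (norm p)\<^sup>2) (at_right 0)"
      by (intro tendsto_intros p)
    show "((\<lambda>e. (norm (z - tikhonov_min f e))\<^sup>2) \<longlongrightarrow> (norm (z - p))\<^sup>2) (at_right 0)"
      by (intro tendsto_intros p)
    show "eventually (\<lambda>e. (norm (z - tikhonov_min f e))\<^sup>2
        \<le> (norm z)\<^sup>2 - (norm (tikhonov_min f e))\<^sup>2) (at_right 0)"
      using eventually_at_right_less[of 0] tikhonov_min_norm_gap[OF z] by (auto elim: eventually_mono)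
  qed simp
  have "min_norm_argmin f = p"
    unfolding min_norm_argmin_def
  proof (rule the_equality)
    have "norm p \<le> norm z" if "z \<in> argmin_set f" for z
      using gap[OF that] zero_le_power2[of "norm (z - p)"]
      by (intro power2_le_imp_le[OF _ norm_ge_zero]) linarith
    with p(1) show "is_arg_min norm (\<lambda>y. y \<in> argmin_set f) p"
      by (simp add: is_arg_min_linorder)
    fix z assume "is_arg_min norm (\<lambda>y. y \<in> argmin_set f) z"
    then have z: "z \<in> argmin_set f" "norm z \<le> norm p" using p(1) by (auto simp: is_arg_min_linorder)
    have "(norm z)\<^sup>2 \<le> (norm p)\<^sup>2" using z(2) by (simp add: power_mono)
    with gap[OF z(1)] have "(norm (z - p))\<^sup>2 \<le> 0" by linarith
    then show "z = p" by simp
  qed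
  with p show "min_norm_argmin f \<in> argmin_set f"
    "(tikhonov_min f \<longlongrightarrow> min_norm_argmin f) (at_right 0)" by simp_all
qed

lemma tikhonov_path_local_lipschitz:
  assumes d: "0 < d" and de: "d \<le> e"
  shows "e * norm (tikhonov_min f d - tikhonov_min f e) \<le> (e - d) * norm (min_norm_argmin f)"
proof -
  let ?p = "tikhonov_min f d" and ?q = "tikhonov_min f d - tikhonov_min f e"
  have "(norm ?p)\<^sup>2 - (norm (tikhonov_min f e))\<^sup>2 = 2 * (?p \<bullet> ?q) - (norm ?q)\<^sup>2"
    unfolding power2_norm_eq_inner by (simp add: inner_diff_left inner_diff_right inner_commute)
  then have "(e + d) * (norm ?q)\<^sup>2 \<le> (e - d) * (2 * (?p \<bullet> ?q) - (norm ?q)\<^sup>2)"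
    using tikhonov_path_step[of d e] d de by simp
  then have "e * (norm ?q)\<^sup>2 \<le> (e - d) * (?p \<bullet> ?q)"
    by (simp only: right_diff_distrib left_diff_distrib distrib_right)
  also have "\<dots> \<le> (e - d) * (norm (min_norm_argmin f) * norm ?q)"
    using de by (intro mult_left_mono order_trans[OF norm_cauchy_schwarz[of ?p ?q]]
        mult_right_mono tikhonov_min_norm_le[OF min_norm_argmin_in d]) auto
  finally have "(e * norm ?q) * norm ?q \<le> ((e - d) * norm (min_norm_argmin f)) * norm ?q"
    by (simp add: power2_eq_square mult.assoc)
  then show ?thesis
    using de by (cases "norm ?q = 0") auto
qed

lemma tikhonov_path_continuous: "continuous_on {0<..} (tikhonov_min f)"
proof (rule continuous_onI)
  fix c r :: real assume c: "c \<in> {0<..}" and r: "0 < r"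
  define N where "N = norm (min_norm_argmin f) + 1"
  have N: "N > 0" unfolding N_def by (simp add: add_nonneg_pos)
  have le: "dist (tikhonov_min f d) (tikhonov_min f c) \<le> \<bar>d - c\<bar> * N / c" if d: "0 < d" for d
  proof -
    let ?n = "norm (tikhonov_min f d - tikhonov_min f c)"
    have "c * ?n \<le> max c d * ?n" by (intro mult_right_mono) auto
    also have "\<dots> \<le> \<bar>d - c\<bar> * norm (min_norm_argmin f)"
      using tikhonov_path_local_lipschitz[of c d] tikhonov_path_local_lipschitz[of d c] c d
      by (cases "d \<le> c") (auto simp: max_def norm_minus_commute)
    also have "\<dots> \<le> \<bar>d - c\<bar> * N" by (intro mult_left_mono) (auto simp: N_def)
    finally show ?thesis using c by (simp add: dist_norm field_simps)
  qed
  have "dist (tikhonov_min f d) (tikhonov_min f c) \<le> r"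
    if "d \<in> {0<..}" "dist d c < r * c / N" for d
  proof -
    have "\<bar>d - c\<bar> * N / c \<le> r"
      using that(2) c N by (simp add: dist_real_def field_simps)
    with le[of d] that(1) show ?thesis by simp
  qed
  moreover have "r * c / N > 0" using r c N by simp
  ultimately show "\<exists>d>0. \<forall>x'\<in>{0<..}. dist x' c < d \<longrightarrow> dist (tikhonov_min f x') (tikhonov_min f c) \<le> r"
    by blast
qed

section \<open>The energy as the regularization parameter decreases\<close>

text \<open>
  The energy of the flow as a function of parameter and position separately, so that the two causes
  of its variation can be estimated one at a time.
\<close>

definition frozen_energy :: "real \<Rightarrow> 'a \<Rightarrow> real" where
  "frozen_energy e v = tikhonov f e v - tikhonov f e (tikhonov_min f e) + e / 2 * (norm (v - tikhonov_min f e))\<^sup>2"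

text \<open>
  Two effects each cost at most \<open>(e - d) N\<^sup>2 / 2\<close>. One is the drop of the minimal value, because
  \<open>tikhonov_min f d\<close> has norm at most \<open>N\<close>. The other is the motion of the minimizer: the resulting cross
  term is absorbed, through the Lipschitz bound on the path and the inequality between arithmetic
  and geometric means, by the decrease of the weight from \<open>e\<close> to \<open>d\<close>.
\<close>

lemma frozen_energy_decrease_parameter:
  assumes d: "0 < d" and de: "d \<le> e"
  shows "frozen_energy d v \<le> frozen_energy e v + (e - d) * (norm (min_norm_argmin f))\<^sup>2"
proof -
  let ?N = "norm (min_norm_argmin f)" and ?a = "tikhonov_min f d" and ?b = "tikhonov_min f e"
  have e: "0 < e" using d de by simp
  have "(e - d) * (norm ?a)\<^sup>2 \<le> (e - d) * ?N\<^sup>2"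
    using de tikhonov_min_norm_le[OF min_norm_argmin_in d]
    by (intro mult_left_mono power_mono) auto
  then have min_part: "tikhonov f e ?b - (e - d) / 2 * ?N\<^sup>2 \<le> tikhonov f d ?a"
    using tikhonov_min_le[OF e, of ?a] by (simp add: tikhonov_def algebra_simps diff_divide_distrib)
  have "0 \<le> (e - d) * (norm v)\<^sup>2" using de by simp
  then have value_part: "tikhonov f d v \<le> tikhonov f e v"
    by (simp add: tikhonov_def algebra_simps)
  have dist_part: "d * (norm (v - ?a))\<^sup>2 \<le> e * (norm (v - ?b))\<^sup>2 + (e - d) * ?N\<^sup>2"
  proof -
    let ?p = "v - ?a" and ?q = "?a - ?b"
    have "- (e * (?p \<bullet> ?q)) \<le> norm ?p * (e * norm ?q)"
      using Cauchy_Schwarz_ineq2[of ?p ?q] e mult_left_mono[of "- (?p \<bullet> ?q)" "norm ?p * norm ?q" e]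
      by (simp add: mult.left_commute)
    also have "\<dots> \<le> norm ?p * ((e - d) * ?N)"
      by (intro mult_left_mono tikhonov_path_local_lipschitz d de) auto
    also have "\<dots> \<le> (e - d) * (((norm ?p)\<^sup>2 + ?N\<^sup>2) / 2)"
      using mult_left_mono[of "norm ?p * ?N" "((norm ?p)\<^sup>2 + ?N\<^sup>2) / 2" "e - d"]
        sum_squares_bound[of "norm ?p" ?N] de
      by (simp add: mult.left_commute)
    finally have cross: "- ((e - d) * ((norm ?p)\<^sup>2 + ?N\<^sup>2)) \<le> 2 * (e * (?p \<bullet> ?q))" by linarith
    have "(norm (v - ?b))\<^sup>2 = (norm (?p + ?q))\<^sup>2" by simp
    also have "\<dots> = (norm ?p)\<^sup>2 + 2 * (?p \<bullet> ?q) + (norm ?q)\<^sup>2"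
      unfolding power2_norm_eq_inner by (simp only: inner_add_left inner_add_right) (simp add: inner_commute)
    finally have "e * (norm (v - ?b))\<^sup>2 = e * (norm ?p)\<^sup>2 + 2 * (e * (?p \<bullet> ?q)) + e * (norm ?q)\<^sup>2"
      by (simp only: distrib_left mult.left_commute)
    moreover have "0 \<le> e * (norm ?q)\<^sup>2" using e by simp
    ultimately show ?thesis using cross by (simp add: algebra_simps)
  qed
  show ?thesis
    using min_part value_part dist_part by (simp add: frozen_energy_def field_simps)
qed

lemma frozen_energy_ge_dist: "0 < e \<Longrightarrow> e * (norm (v - tikhonov_min f e))\<^sup>2 \<le> frozen_energy e v"
  using tikhonov_min_growth[of e v] by (simp add: frozen_energy_def field_simps)

lemma value_gap_le_frozen_energy:
  assumes z: "z \<in> argmin_set f" and e: "0 < e"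
  shows "f v - f z \<le> frozen_energy e v + e / 2 * (norm z)\<^sup>2"
proof -
  have "0 \<le> e / 2 * (norm v)\<^sup>2" "0 \<le> e / 2 * (norm (v - tikhonov_min f e))\<^sup>2" using e by simp_all
  then show ?thesis
    using tikhonov_min_le[OF e, of z] by (simp add: frozen_energy_def tikhonov_def)
qed

lemma frozen_energy_continuous: "continuous_on ({0<..} \<times> UNIV) (\<lambda>(e, v). frozen_energy e v)"
proof -
  have y: "continuous_on ({0<..} \<times> UNIV) (\<lambda>p::real \<times> 'a. tikhonov_min f (fst p))"
    by (rule continuous_on_compose2[OF tikhonov_path_continuous continuous_on_fst[OF continuous_on_id]]) auto
  show ?thesis
    unfolding frozen_energy_def tikhonov_def case_prod_beta
    by (intro continuous_intros y continuous_on_compose2[OF cont]) auto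
qed

end

section \<open>The Tikhonov flow\<close>

text \<open>
  The first-order inequality for convex functions, reduced to the real line by restricting \<open>f\<close> to the
  line through \<open>v\<close> and \<open>z\<close>.
\<close>

lemma convex_above_tangent_plane:
  assumes "convex_on UNIV f" and grad: "GDERIV f v :> w"
  shows "f v + (z - v) \<bullet> w \<le> f z"
proof -
  define h where "h = (\<lambda>s. f (v + s *\<^sub>R (z - v)))"
  have convex: "convex_on UNIV h"
  proof (rule convex_onI)
    fix t a b :: real assume t: "0 < t" "t < 1"
    have "v + ((1 - t) *\<^sub>R a + t *\<^sub>R b) *\<^sub>R (z - v)
        = (1 - t) *\<^sub>R (v + a *\<^sub>R (z - v)) + t *\<^sub>R (v + b *\<^sub>R (z - v))"
      by (simp add: algebra_simps)
    then show "h ((1 - t) *\<^sub>R a + t *\<^sub>R b) \<le> (1 - t) * h a + t * h b"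
      unfolding h_def using convex_onD[OF assms(1)] t by simp
  qed simp
  have "((\<lambda>s::real. v + s *\<^sub>R (z - v)) has_derivative (\<lambda>s. s *\<^sub>R (z - v))) (at 0)"
    by (auto intro!: derivative_eq_intros)
  moreover have "(f has_derivative (\<lambda>k. k \<bullet> w)) (at (v + 0 *\<^sub>R (z - v)))"
    using grad by (simp add: gderiv_def)
  ultimately have "(h has_derivative (\<lambda>s. (s *\<^sub>R (z - v)) \<bullet> w)) (at 0)"
    unfolding h_def by (rule has_derivative_compose)
  then have "(h has_real_derivative (z - v) \<bullet> w) (at 0)"
    by (simp add: has_field_derivative_def mult.commute[of _ "(z - v) \<bullet> w"] mult_commute_abs)
  then have "h 1 - h 0 \<ge> ((z - v) \<bullet> w) * (1 - 0)"
    by (intro convex_on_imp_above_tangent[OF convex]) auto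
  then show ?thesis by (simp add: h_def)
qed

locale tikhonov_flow = convex_attaining_min f
  for f :: "'a::{real_inner, complete_space} \<Rightarrow> real" +
  fixes g :: "'a \<Rightarrow> 'a" and \<epsilon> \<epsilon>' :: "real \<Rightarrow> real" and x x' :: "real \<Rightarrow> 'a" and t0 :: real
  assumes grad: "GDERIV f z :> g z"
    and eps_pos: "t \<ge> t0 \<Longrightarrow> \<epsilon> t > 0"
    and eps_antimono: "antimono_on {t0..} \<epsilon>"
    and eps_deriv: "t \<ge> t0 \<Longrightarrow> (\<epsilon> has_real_derivative \<epsilon>' t) (at t within {t0..})"
    and eps_deriv_cont: "continuous_on {t0..} \<epsilon>'"
    and eps_lim: "(\<epsilon> \<longlongrightarrow> 0) at_top"
    and x_deriv: "t \<ge> t0 \<Longrightarrow> (x has_vector_derivative x' t) (at t within {t0..})"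
    and ode: "t \<ge> t0 \<Longrightarrow> x' t = - (g (x t) + \<epsilon> t *\<^sub>R x t)"
begin

abbreviation "xs \<equiv> min_norm_argmin f"
abbreviation "E \<equiv> energy f \<epsilon> x"

lemma tikhonov_above_tangent_paraboloid:
  "tikhonov f e v + (z - v) \<bullet> (g v + e *\<^sub>R v) + e / 2 * (norm (z - v))\<^sup>2 \<le> tikhonov f e z"
proof -
  have "(norm z)\<^sup>2 = (norm v)\<^sup>2 + 2 * ((z - v) \<bullet> v) + (norm (z - v))\<^sup>2"
    unfolding power2_norm_eq_inner by (simp add: inner_diff_left inner_diff_right inner_commute)
  then have "e / 2 * (norm z)\<^sup>2
      = e / 2 * (norm v)\<^sup>2 + e * ((z - v) \<bullet> v) + e / 2 * (norm (z - v))\<^sup>2"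
    by (simp add: distrib_left)
  then show ?thesis
    using convex_above_tangent_plane[OF convex grad, of v z]
    unfolding tikhonov_def inner_add_right inner_scaleR_right by linarith
qed

lemma eps_cont: "continuous_on {t0..} \<epsilon>"
  by (rule DERIV_continuous_on[OF eps_deriv]) auto

lemma x_cont: "continuous_on {t0..} x"
  using x_deriv by (intro continuous_on_vector_derivative) auto

lemma energy_eq: "E t = frozen_energy (\<epsilon> t) (x t)"
  by (simp add: energy_def frozen_energy_def)

lemma energy_cont: "continuous_on {t0..} E"
proof -
  have "continuous_on {t0..} (\<lambda>t. (\<lambda>(e, v). frozen_energy e v) (\<epsilon> t, x t))"
    by (rule continuous_on_compose2[OF frozen_energy_continuous])
      (auto intro!: continuous_intros eps_cont x_cont eps_pos)
  then show ?thesis by (simp add: energy_eq[abs_def])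
qed

lemma square_dist_deriv:
  assumes t: "t \<ge> t0"
  shows "((\<lambda>s. (norm (x s - c))\<^sup>2) has_real_derivative 2 * ((x t - c) \<bullet> x' t)) (at t within {t0..})"
proof -
  have "((\<lambda>s. x s - c) has_vector_derivative x' t) (at t within {t0..})"
    by (auto intro!: derivative_eq_intros x_deriv[OF t])
  then have d: "((\<lambda>s. x s - c) has_derivative (\<lambda>h. h *\<^sub>R x' t)) (at t within {t0..})"
    by (simp add: has_vector_derivative_def)
  have "((\<lambda>s. (x s - c) \<bullet> (x s - c)) has_derivative
      (\<lambda>h. (x t - c) \<bullet> (h *\<^sub>R x' t) + (h *\<^sub>R x' t) \<bullet> (x t - c))) (at t within {t0..})"
    by (rule has_derivative_inner[OF d d])
  moreover have "(\<lambda>h. (x t - c) \<bullet> (h *\<^sub>R x' t) + (h *\<^sub>R x' t) \<bullet> (x t - c))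
      = (*) (2 * ((x t - c) \<bullet> x' t))"
    by (rule ext) (simp add: inner_commute)
  ultimately show ?thesis
    by (simp add: power2_norm_eq_inner has_field_derivative_def)
qed

lemma value_deriv:
  assumes t: "t \<ge> t0"
  shows "((\<lambda>s. f (x s)) has_real_derivative x' t \<bullet> g (x t)) (at t within {t0..})"
proof -
  have "(x has_derivative (\<lambda>h. h *\<^sub>R x' t)) (at t within {t0..})"
    using x_deriv[OF t] by (simp add: has_vector_derivative_def)
  moreover have "(f has_derivative (\<lambda>k. k \<bullet> g (x t))) (at (x t))"
    using grad by (simp add: gderiv_def)
  ultimately have "((\<lambda>s. f (x s)) has_derivative (\<lambda>h. (h *\<^sub>R x' t) \<bullet> g (x t))) (at t within {t0..})"
    by (rule has_derivative_compose)
  moreover have "(\<lambda>h. (h *\<^sub>R x' t) \<bullet> g (x t)) = (*) (x' t \<bullet> g (x t))"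
    by (rule ext) simp
  ultimately show ?thesis by (simp add: has_field_derivative_def)
qed

text \<open>
  With \<open>G\<close> the gradient of \<open>tikhonov f (\<epsilon> t)\<close> at \<open>x t\<close>, the derivative is
  \<open>- \<bar>G\<bar>\<^sup>2 - \<epsilon> (x - y) \<bullet> G\<close>, and the tangent paraboloid at \<open>x t\<close>, compared with the value at the minimizer
  \<open>y\<close>, bounds \<open>(x - y) \<bullet> G\<close> from below by exactly the energy.
\<close>

lemma frozen_energy_dissipation:
  assumes t: "t \<ge> t0"
  shows "\<exists>D. ((\<lambda>s. frozen_energy (\<epsilon> t) (x s)) has_real_derivative D) (at t within {t0..})
    \<and> D \<le> - \<epsilon> t * E t"
proof -
  let ?y = "tikhonov_min f (\<epsilon> t)" and ?G = "g (x t) + \<epsilon> t *\<^sub>R x t"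
  define D where "D = x' t \<bullet> g (x t) + \<epsilon> t / 2 * (2 * (x t \<bullet> x' t))
    + \<epsilon> t / 2 * (2 * ((x t - ?y) \<bullet> x' t))"
  have "((\<lambda>s. frozen_energy (\<epsilon> t) (x s)) has_real_derivative D) (at t within {t0..})"
    unfolding frozen_energy_def tikhonov_def D_def
    using DERIV_add[OF DERIV_diff[OF DERIV_add[OF value_deriv[OF t]
          DERIV_cmult[OF square_dist_deriv[OF t, of 0, unfolded diff_zero], of "\<epsilon> t / 2"]] DERIV_const]
        DERIV_cmult[OF square_dist_deriv[OF t, of ?y], of "\<epsilon> t / 2"]]
    by (simp only: diff_zero)
  moreover have "D \<le> - \<epsilon> t * E t"
  proof -
    have "D = x' t \<bullet> ?G + \<epsilon> t * ((x t - ?y) \<bullet> x' t)"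
      by (simp add: D_def inner_add_right inner_commute)
    also have "\<dots> = - (norm ?G)\<^sup>2 + \<epsilon> t * ((?y - x t) \<bullet> ?G)"
      using ode[OF t] by (simp add: power2_norm_eq_inner inner_diff_left del: minus_add_distrib)
    also have "\<dots> \<le> \<epsilon> t * ((?y - x t) \<bullet> ?G)" by simp
    also have "\<dots> \<le> \<epsilon> t * (- E t)"
      using tikhonov_above_tangent_paraboloid[of "\<epsilon> t" "x t" ?y] eps_pos[OF t]
      by (intro mult_left_mono) (simp_all add: energy_def norm_minus_commute)
    finally show ?thesis by simp
  qed
  ultimately show ?thesis by blast
qed

lemma gam_pos: "gam \<epsilon> a t > 0"
  by (simp add: gam_def)

lemma gam_deriv:
  assumes "t0 \<le> a" "a \<le> t" "t \<le> b"
  shows "(gam \<epsilon> a has_real_derivative gam \<epsilon> a t * \<epsilon> t) (at t within {a..b})"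
proof -
  have "continuous_on {a..b} \<epsilon>" using assms by (intro continuous_on_subset[OF eps_cont]) auto
  then have "((\<lambda>s. integral {a..s} \<epsilon>) has_real_derivative \<epsilon> t) (at t within {a..b})"
    using assms by (intro integral_has_real_derivative) auto
  then show ?thesis
    unfolding gam_def[abs_def] by (auto intro!: derivative_eq_intros)
qed

lemma gam_cont: "t0 \<le> a \<Longrightarrow> continuous_on {a..b} (gam \<epsilon> a)"
  by (rule DERIV_continuous_on[OF gam_deriv]) auto

text \<open>
  The majorant at \<open>t\<close> freezes the parameter at \<open>\<epsilon> t\<close> and charges \<open>(\<epsilon> t - \<epsilon> s) N\<^sup>2\<close> for its later
  decrease. In the derivative at \<open>t\<close> this charge cancels against that of the integral, and the
  dissipation of the frozen energy cancels the growth of \<open>\<gamma>\<close>.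
\<close>

lemma weighted_energy_bound:
  assumes a: "t0 \<le> a" and ab: "a \<le> b"
  shows "gam \<epsilon> a b * E b + (norm xs)\<^sup>2 * integral {a..b} (\<lambda>s. \<epsilon>' s * gam \<epsilon> a s)
    \<le> gam \<epsilon> a a * E a"
proof -
  define J where "J = (\<lambda>t. integral {a..t} (\<lambda>s. \<epsilon>' s * gam \<epsilon> a s))"
  define u where "u = (\<lambda>t. gam \<epsilon> a t * E t + (norm xs)\<^sup>2 * J t)"
  have integrand_cont: "continuous_on {a..b} (\<lambda>s. \<epsilon>' s * gam \<epsilon> a s)"
    using a by (intro continuous_intros gam_cont continuous_on_subset[OF eps_deriv_cont]) auto
  have J_deriv: "(J has_real_derivative \<epsilon>' t * gam \<epsilon> a t) (at t within {a..b})"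
    if "t \<in> {a..b}" for t
    unfolding J_def using integral_has_real_derivative[OF integrand_cont that] .
  have "u b \<le> u a"
  proof (rule nonincreasing_if_right_majorants[OF ab])
    have "continuous_on {a..b} J" by (rule DERIV_continuous_on[OF J_deriv])
    then show "continuous_on {a..b} u"
      unfolding u_def using a
      by (intro continuous_intros gam_cont continuous_on_subset[OF energy_cont]) auto
  next
    fix t assume t: "a \<le> t" "t < b"
    then have t0: "t0 \<le> t" using a by simp
    obtain D where D: "((\<lambda>s. frozen_energy (\<epsilon> t) (x s)) has_real_derivative D) (at t within {t0..})"
        "D \<le> - \<epsilon> t * E t"
      using frozen_energy_dissipation[OF t0] by blast
    define M where "M = (\<lambda>s. gam \<epsilon> a s *
      (frozen_energy (\<epsilon> t) (x s) + (\<epsilon> t - \<epsilon> s) * (norm xs)\<^sup>2) + (norm xs)\<^sup>2 * J s)"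
    have "M t = u t" by (simp add: M_def u_def energy_eq)
    moreover have "u s \<le> M s" if s: "s \<in> {t..b}" for s
    proof -
      have "\<epsilon> s \<le> \<epsilon> t" using monotone_onD[OF eps_antimono, of t s] s t0 by simp
      moreover have "0 < \<epsilon> s" using eps_pos s t0 by simp
      ultimately show ?thesis
        unfolding u_def M_def energy_eq
        by (intro add_right_mono mult_left_mono frozen_energy_decrease_parameter less_imp_le[OF gam_pos])
    qed
    moreover have "(M has_real_derivative gam \<epsilon> a t * \<epsilon> t * E t + gam \<epsilon> a t * D) (at t within {t..b})"
    proof -
      have sub: "{t..b} \<subseteq> {t0..}" "{t..b} \<subseteq> {a..b}" using t a by auto
      note D' = DERIV_subset[OF D(1) sub(1)]
      note eps' = DERIV_subset[OF eps_deriv[OF t0] sub(1)]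
      note gam' = DERIV_subset[OF gam_deriv[OF a t(1) less_imp_le[OF t(2)]] sub(2)]
      have "t \<in> {a..b}" using t by simp
      note J' = DERIV_subset[OF J_deriv[OF this] sub(2)]
      show ?thesis
        unfolding M_def
        by (rule derivative_eq_intros D' eps' gam' J' refl)+
          (simp add: energy_eq algebra_simps)
    qed
    moreover have "gam \<epsilon> a t * \<epsilon> t * E t + gam \<epsilon> a t * D \<le> 0"
      using mult_left_mono[OF D(2) less_imp_le[OF gam_pos[of a t]]] by (simp add: algebra_simps)
    ultimately show "\<exists>M D. M t = u t \<and> (\<forall>s\<in>{t..b}. u s \<le> M s) \<and>
        (M has_real_derivative D) (at t within {t..b}) \<and> D \<le> 0"
      by blast
  qed
  then show ?thesis by (simp add: u_def J_def)
qed

lemma path_along_eps_tendsto: "((\<lambda>t. tikhonov_min f (\<epsilon> t)) \<longlongrightarrow> xs) at_top"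
proof (rule filterlim_compose[OF tikhonov_path_tendsto])
  have "eventually (\<lambda>t. \<epsilon> t > 0) at_top"
    using eventually_ge_at_top[of t0] by eventually_elim (rule eps_pos)
  then show "filterlim \<epsilon> (at_right 0) at_top"
    using eps_lim by (simp add: filterlim_at_right_to_0 tendsto_imp_filterlim_at_right)
qed

lemma convergence_if_energy_negligible:
  assumes lim: "((\<lambda>t. E t / \<epsilon> t) \<longlongrightarrow> 0) at_top"
  shows "(x \<longlongrightarrow> xs) at_top"
proof -
  have "((\<lambda>t. (norm (x t - tikhonov_min f (\<epsilon> t)))\<^sup>2) \<longlongrightarrow> 0) at_top"
  proof (rule tendsto_sandwich[OF _ _ tendsto_const lim])
    show "eventually (\<lambda>t. (norm (x t - tikhonov_min f (\<epsilon> t)))\<^sup>2 \<le> E t / \<epsilon> t) at_top"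
      using eventually_ge_at_top[of t0]
    proof eventually_elim
      case (elim t)
      then show ?case
        using frozen_energy_ge_dist[OF eps_pos, of t "x t"] eps_pos[of t]
        by (simp add: energy_eq pos_le_divide_eq mult.commute)
    qed
  qed simp
  then have "((\<lambda>t. sqrt ((norm (x t - tikhonov_min f (\<epsilon> t)))\<^sup>2)) \<longlongrightarrow> sqrt 0) at_top"
    by (rule tendsto_real_sqrt)
  then have "((\<lambda>t. x t - tikhonov_min f (\<epsilon> t)) \<longlongrightarrow> 0) at_top"
    by (simp add: tendsto_norm_zero_iff)
  from tendsto_add[OF this path_along_eps_tendsto] show ?thesis by simp
qed

text \<open>
  The tangent paraboloid at \<open>x t\<close> is compared with the value at \<open>xs\<close>, and the value at \<open>x t\<close> with the
  minimum. The values of \<open>f\<close> drop out because \<open>xs\<close> minimizes \<open>f\<close>.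
\<close>

lemma square_dist_dissipation:
  assumes t: "t \<ge> t0"
  shows "2 * ((x t - xs) \<bullet> x' t)
    \<le> \<epsilon> t * ((norm xs)\<^sup>2 - (norm (tikhonov_min f (\<epsilon> t)))\<^sup>2 - (norm (x t - xs))\<^sup>2)"
proof -
  let ?y = "tikhonov_min f (\<epsilon> t)" and ?G = "g (x t) + \<epsilon> t *\<^sub>R x t"
  have "(x t - xs) \<bullet> x' t = (xs - x t) \<bullet> ?G"
    using ode[OF t] by (simp add: inner_diff_left del: minus_add_distrib)
  also have "\<dots> \<le> tikhonov f (\<epsilon> t) xs - tikhonov f (\<epsilon> t) ?y - \<epsilon> t / 2 * (norm (x t - xs))\<^sup>2"
    using tikhonov_above_tangent_paraboloid[of "\<epsilon> t" "x t" xs]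
      tikhonov_min_le[OF eps_pos[OF t], of "x t"] by (simp add: norm_minus_commute)
  also have "\<dots> \<le> \<epsilon> t / 2 * (norm xs)\<^sup>2 - \<epsilon> t / 2 * (norm ?y)\<^sup>2 - \<epsilon> t / 2 * (norm (x t - xs))\<^sup>2"
    using argmin_le[OF min_norm_argmin_in, of ?y] by (simp add: tikhonov_def)
  finally show ?thesis by (simp add: right_diff_distrib)
qed

lemma gam_at_top:
  assumes div: "filterlim (\<lambda>T. integral {t0..T} \<epsilon>) at_top at_top" and a: "t0 \<le> a"
  shows "filterlim (gam \<epsilon> a) at_top at_top"
proof -
  have "filterlim (\<lambda>t. - integral {t0..a} \<epsilon> + integral {t0..t} \<epsilon>) at_top at_top"
    by (rule filterlim_tendsto_add_at_top[OF tendsto_const div])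
  moreover have "eventually (\<lambda>t. - integral {t0..a} \<epsilon> + integral {t0..t} \<epsilon> = integral {a..t} \<epsilon>) at_top"
    using eventually_ge_at_top[of a]
  proof eventually_elim
    case (elim t)
    have "\<epsilon> integrable_on {t0..t}"
      by (intro integrable_continuous_interval continuous_on_subset[OF eps_cont]) auto
    from Henstock_Kurzweil_Integration.integral_combine[OF a elim this] show ?case by simp
  qed
  ultimately have "filterlim (\<lambda>t. integral {a..t} \<epsilon>) at_top at_top"
    using filterlim_cong[OF refl refl] by fast
  then show ?thesis
    unfolding gam_def[abs_def] by (rule filterlim_compose[OF exp_at_top])
qed

text \<open>
  Once \<open>N\<^sup>2 - \<bar>y\<^sub>\<epsilon>\<bar>\<^sup>2\<close> stays below \<open>\<eta>\<close>, the function \<open>\<gamma> (\<theta> - \<eta>)\<close> is nonincreasing, so that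
  \<open>\<theta> \<le> \<eta> + O(1/\<gamma>)\<close>.
\<close>

lemma convergence_if_eps_not_integrable:
  assumes div: "filterlim (\<lambda>T. integral {t0..T} \<epsilon>) at_top at_top"
  shows "(x \<longlongrightarrow> xs) at_top"
proof -
  have "((\<lambda>t. (norm (x t - xs))\<^sup>2) \<longlongrightarrow> 0) at_top"
  proof (rule tendstoI)
    fix r :: real assume r: "0 < r"
    define \<eta> where "\<eta> = r / 2"
    have eta: "0 < \<eta>" using r by (simp add: \<eta>_def)
    have "((\<lambda>t. (norm xs)\<^sup>2 - (norm (tikhonov_min f (\<epsilon> t)))\<^sup>2) \<longlongrightarrow> (norm xs)\<^sup>2 - (norm xs)\<^sup>2) at_top"
      by (intro tendsto_intros path_along_eps_tendsto)
    then have "eventually (\<lambda>t. (norm xs)\<^sup>2 - (norm (tikhonov_min f (\<epsilon> t)))\<^sup>2 < \<eta>) at_top"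
      using eta by (intro order_tendstoD(2)) auto
    then obtain T where T: "T \<ge> t0"
        "\<And>t. t \<ge> T \<Longrightarrow> (norm xs)\<^sup>2 - (norm (tikhonov_min f (\<epsilon> t)))\<^sup>2 < \<eta>"
      unfolding eventually_at_top_linorder by (meson max.bounded_iff max.cobounded1)
    let ?\<theta> = "\<lambda>t. (norm (x t - xs))\<^sup>2"
    define u where "u = (\<lambda>t. gam \<epsilon> T t * (?\<theta> t - \<eta>))"
    have decay: "u b \<le> u T" if b: "T \<le> b" for b
    proof (rule nonincreasing_if_right_majorants[OF b])
      have "continuous_on {T..b} x" using T(1) by (intro continuous_on_subset[OF x_cont]) auto
      then show "continuous_on {T..b} u"
        unfolding u_def by (intro continuous_intros gam_cont T(1))
    next
      fix t assume t: "T \<le> t" "t < b"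
      then have t0: "t0 \<le> t" using T(1) by simp
      define D where "D = gam \<epsilon> T t * \<epsilon> t * (?\<theta> t - \<eta>) + gam \<epsilon> T t * (2 * ((x t - xs) \<bullet> x' t))"
      have sub: "{t..b} \<subseteq> {t0..}" "{t..b} \<subseteq> {T..b}" using t t0 by auto
      note gam' = DERIV_subset[OF gam_deriv[OF T(1) t(1) less_imp_le[OF t(2)]] sub(2)]
      note dist' = DERIV_subset[OF square_dist_deriv[OF t0] sub(1)]
      have "(u has_real_derivative D) (at t within {t..b})"
        unfolding u_def D_def
        by (rule derivative_eq_intros gam' dist' refl)+ (simp add: algebra_simps)
      moreover have "D \<le> 0"
      proof -
        have "2 * ((x t - xs) \<bullet> x' t) \<le> \<epsilon> t * (\<eta> - ?\<theta> t)"
          using T(2)[OF t(1)] eps_pos[OF t0]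
          by (intro order_trans[OF square_dist_dissipation[OF t0]] mult_left_mono) auto
        from mult_left_mono[OF this less_imp_le[OF gam_pos[of T t]]]
        show ?thesis by (simp add: D_def algebra_simps)
      qed
      ultimately show "\<exists>M D. M t = u t \<and> (\<forall>s\<in>{t..b}. u s \<le> M s) \<and>
          (M has_real_derivative D) (at t within {t..b}) \<and> D \<le> 0"
        by blast
    qed
    have "((\<lambda>t. u T / gam \<epsilon> T t) \<longlongrightarrow> 0) at_top"
      by (rule real_tendsto_divide_at_top[OF tendsto_const gam_at_top[OF div T(1)]])
    then have "eventually (\<lambda>t. u T / gam \<epsilon> T t < \<eta>) at_top"
      using eta by (rule order_tendstoD(2))
    then show "eventually (\<lambda>t. dist (?\<theta> t) 0 < r) at_top"
      using eventually_ge_at_top[of T]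
    proof eventually_elim
      case (elim t)
      have "?\<theta> t - \<eta> \<le> u T / gam \<epsilon> T t"
        using decay[OF elim(2)] gam_pos[of T t] by (simp add: u_def pos_le_divide_eq mult.commute)
      with elim(1) have "?\<theta> t < r" unfolding \<eta>_def by linarith
      then show ?case by simp
    qed
  qed
  then have "((\<lambda>t. sqrt ((norm (x t - xs))\<^sup>2)) \<longlongrightarrow> sqrt 0) at_top"
    by (rule tendsto_real_sqrt)
  then have "((\<lambda>t. x t - xs) \<longlongrightarrow> 0) at_top"
    by (simp add: tendsto_norm_zero_iff)
  then show ?thesis by (rule LIM_zero_cancel)
qed

end

section \<open>Energy decay and strong convergence\<close>

theorem theorem3:
  fixes f :: "'a::{real_inner, complete_space} \<Rightarrow> real"
    and g :: "'a \<Rightarrow> 'a"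
    and \<epsilon> \<epsilon>' :: "real \<Rightarrow> real"
    and x :: "real \<Rightarrow> 'a"
    and t0 :: real
  assumes f_convex: "convex_on UNIV f"
    and f_grad: "\<And>z. GDERIV f z :> g z"
    and g_cont: "continuous_on UNIV g"
    and g_lip: "\<And>B. bounded B \<Longrightarrow> \<exists>L. L-lipschitz_on B g"
    and argmin_ne: "argmin_set f \<noteq> {}"
    and eps_pos: "\<And>t. t \<ge> t0 \<Longrightarrow> \<epsilon> t > 0"
    and eps_antimono: "antimono_on {t0..} \<epsilon>"
    and eps_deriv: "\<And>t. t \<ge> t0 \<Longrightarrow> (\<epsilon> has_real_derivative \<epsilon>' t) (at t within {t0..})"
    and eps_deriv_cont: "continuous_on {t0..} \<epsilon>'"
    and eps_lim: "(\<epsilon> \<longlongrightarrow> 0) at_top"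
    and sol: "solution_trajectory g \<epsilon> t0 x"
  defines "xs \<equiv> min_norm_argmin f"
    and "E \<equiv> energy f \<epsilon> x"
  shows "(\<exists>t1>0. t1 \<ge> t0 \<and> (\<forall>t\<ge>t1.
            E t \<le> gam \<epsilon> t1 t1 * E t1 / gam \<epsilon> t1 t
                   - (norm xs)\<^sup>2 / gam \<epsilon> t1 t * integral {t1..t} (\<lambda>s. \<epsilon>' s * gam \<epsilon> t1 s)
          \<and> f (x t) - (INF z. f z)
              \<le> gam \<epsilon> t1 t1 * E t1 / gam \<epsilon> t1 t
                 + (norm xs)\<^sup>2 / 2 *
                   (\<epsilon> t - 2 / gam \<epsilon> t1 t * integral {t1..t} (\<lambda>s. \<epsilon>' s * gam \<epsilon> t1 s))
          \<and> (norm (x t - tikhonov_min f (\<epsilon> t)))\<^sup>2 \<le> E t / \<epsilon> t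
          \<and> E t / \<epsilon> t
              \<le> gam \<epsilon> t1 t1 * E t1 / (\<epsilon> t * gam \<epsilon> t1 t)
                 - (norm xs)\<^sup>2 / (\<epsilon> t * gam \<epsilon> t1 t)
                   * integral {t1..t} (\<lambda>s. \<epsilon>' s * gam \<epsilon> t1 s)))
       \<and> (((\<lambda>t. E t / \<epsilon> t) \<longlongrightarrow> 0) at_top
            \<or> filterlim (\<lambda>T. integral {t0..T} \<epsilon>) at_top at_top
          \<longrightarrow> (x \<longlongrightarrow> xs) at_top)"
proof -
  obtain x' where x': "\<And>t. t \<ge> t0 \<Longrightarrow> (x has_vector_derivative x' t) (at t within {t0..})"
      "\<And>t. t \<ge> t0 \<Longrightarrow> x' t + g (x t) + \<epsilon> t *\<^sub>R x t = 0"
    using sol unfolding solution_trajectory_def by blast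
  have "isCont f z" for z
    using f_grad[of z] by (auto simp: gderiv_def intro: has_derivative_continuous)
  then have f_cont: "continuous_on UNIV f" by (simp add: continuous_on_eq_continuous_at)
  interpret tikhonov_flow f g \<epsilon> \<epsilon>' x x' t0
  proof unfold_locales
    show "x' t = - (g (x t) + \<epsilon> t *\<^sub>R x t)" if "t \<ge> t0" for t
      using x'(2)[OF that] by (simp only: add.assoc eq_neg_iff_add_eq_0)
  qed (fact f_convex f_cont argmin_ne f_grad eps_pos eps_antimono eps_deriv eps_deriv_cont
      eps_lim x'(1))+
  have xs: "xs \<in> argmin_set f" unfolding xs_def by (rule min_norm_argmin_in)
  have inf: "(INF z. f z) = f xs"
    using argmin_le[OF xs] by (intro antisym cINF_lower cINF_greatest bdd_belowI2) auto
  \<comment> \<open>The bounds hold from every starting time; the maximum with \<open>1\<close> only secures positivity.\<close>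
  define t1 where "t1 = max t0 1"
  have t1: "0 < t1" "t0 \<le> t1" by (auto simp: t1_def)
  define J where "J = (\<lambda>t. integral {t1..t} (\<lambda>s. \<epsilon>' s * gam \<epsilon> t1 s))"
  have bounds: "E t \<le> gam \<epsilon> t1 t1 * E t1 / gam \<epsilon> t1 t - (norm xs)\<^sup>2 / gam \<epsilon> t1 t * J t
      \<and> f (x t) - (INF z. f z) \<le> gam \<epsilon> t1 t1 * E t1 / gam \<epsilon> t1 t
          + (norm xs)\<^sup>2 / 2 * (\<epsilon> t - 2 / gam \<epsilon> t1 t * J t)
      \<and> (norm (x t - tikhonov_min f (\<epsilon> t)))\<^sup>2 \<le> E t / \<epsilon> t
      \<and> E t / \<epsilon> t \<le> gam \<epsilon> t1 t1 * E t1 / (\<epsilon> t * gam \<epsilon> t1 t)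
          - (norm xs)\<^sup>2 / (\<epsilon> t * gam \<epsilon> t1 t) * J t"
    if t: "t \<ge> t1" for t
  proof -
    have e: "0 < \<epsilon> t" using eps_pos t t1 by simp
    let ?\<gamma> = "gam \<epsilon> t1 t" and ?A = "gam \<epsilon> t1 t1 * E t1"
    have "E t * ?\<gamma> \<le> ?A - (norm xs)\<^sup>2 * J t"
      using weighted_energy_bound[OF t1(2) t]
      by (simp add: E_def xs_def J_def mult.commute)
    then have "E t \<le> (?A - (norm xs)\<^sup>2 * J t) / ?\<gamma>"
      by (simp add: pos_le_divide_eq[OF gam_pos])
    then have decay: "E t \<le> ?A / ?\<gamma> - (norm xs)\<^sup>2 / ?\<gamma> * J t"
      by (simp add: diff_divide_distrib)
    have "f (x t) - f xs \<le> E t + \<epsilon> t / 2 * (norm xs)\<^sup>2"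
      using value_gap_le_frozen_energy[OF xs e] by (simp add: E_def energy_eq)
    also have "\<dots> \<le> ?A / ?\<gamma> - (norm xs)\<^sup>2 / ?\<gamma> * J t + \<epsilon> t / 2 * (norm xs)\<^sup>2"
      using decay by simp
    also have "\<dots> = ?A / ?\<gamma> + (norm xs)\<^sup>2 / 2 * (\<epsilon> t - 2 / ?\<gamma> * J t)"
      by (simp add: right_diff_distrib mult.commute)
    finally have "f (x t) - f xs \<le> \<dots>" .
    moreover have "(norm (x t - tikhonov_min f (\<epsilon> t)))\<^sup>2 \<le> E t / \<epsilon> t"
      using frozen_energy_ge_dist[OF e, of "x t"] e
      by (simp add: E_def energy_eq pos_le_divide_eq mult.commute)
    moreover have "E t / \<epsilon> t \<le> (?A / ?\<gamma> - (norm xs)\<^sup>2 / ?\<gamma> * J t) / \<epsilon> t"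
      using decay e by (intro divide_right_mono) auto
    then have "E t / \<epsilon> t \<le> ?A / (\<epsilon> t * ?\<gamma>) - (norm xs)\<^sup>2 / (\<epsilon> t * ?\<gamma>) * J t"
      by (simp add: diff_divide_distrib mult.commute)
    ultimately show ?thesis using decay inf by simp
  qed
  moreover have "(x \<longlongrightarrow> xs) at_top"
    if "((\<lambda>t. E t / \<epsilon> t) \<longlongrightarrow> 0) at_top
      \<or> filterlim (\<lambda>T. integral {t0..T} \<epsilon>) at_top at_top"
    using that convergence_if_energy_negligible convergence_if_eps_not_integrable
    unfolding E_def xs_def by blast
  ultimately show ?thesis
    using t1 unfolding J_def by blast
qed

end
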